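(* Let $\ell \geq 2$ be an integer, and let $\varepsilon_0 \in (0,\frac{1}{2\ell})$ and $d_0 \ge 1/\varepsilon_0$ be real. Let $G=(A,B)$ be a bipartite graph such that $|A| > \ell |B|$ and every vertex in $A$ has at least $d_0$ neighbors in $B$. Then $G$ contains at least one of the following: (i) a subgraph $H$ with $|V(H)| \le 3d_0$ and $|E(H)|\ge \varepsilon_0^2 d_0^2/2$, or (ii) an $(\ell+1)$-bounded minor $G'$ with $\mathrm{d}(G') \ge \frac{\ell}{2}(1- 2 \ell \varepsilon_0)d_0$.
   Context: All graphs are finite and simple. $\mathrm{d}(G)=|E(G)|/|V(G)|$ denotes density. An $m$-bounded minor of $G$ is a minor having a model in $G$ in which every branch set has at most $m$ vertices (i.e. obtained from a subgraph by contracting connected subgraphs on at most $m$ vertices). *)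

theory Defs
  imports Complex_Main "Graph_Theory.Graph_Theory"
begin

text \<open>
  Finite simple graphs are represented, as usual in Graph_Theory, by finite symmetric loop-free
  digraphs without parallel arcs (\<^locale>\<open>pair_graph\<close>). An undirected edge \<open>uv\<close> is thus stored as
  the two arcs \<open>(u, v)\<close> and \<open>(v, u)\<close>, so \<open>|E(G)|\<close> must be counted on unordered pairs.
\<close>

definition uedges :: "'a pair_pre_digraph \<Rightarrow> 'a set set" where
  "uedges G = {{u, v} | u v. (u, v) \<in> parcs G}"

definition density :: "'a pair_pre_digraph \<Rightarrow> real" where
  "density G = real (card (uedges G)) / real (card (pverts G))"

definition bipartition :: "'a pair_pre_digraph \<Rightarrow> 'a set \<Rightarrow> 'a set \<Rightarrow> bool" where
  "bipartition G A B \<longleftrightarrow> pverts G = A \<union> B \<and> A \<inter> B = {} \<and>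
     (\<forall>(u, v) \<in> parcs G. u \<in> A \<and> v \<in> B \<or> u \<in> B \<and> v \<in> A)"

definition minor_model ::
  "('b \<Rightarrow> 'a set) \<Rightarrow> 'b pair_pre_digraph \<Rightarrow> 'a pair_pre_digraph \<Rightarrow> bool" where
  "minor_model \<mu> H G \<longleftrightarrow>
     (\<forall>x \<in> pverts H. \<mu> x \<subseteq> pverts G \<and> connected (with_proj G \<restriction> \<mu> x)) \<and>
     (\<forall>x \<in> pverts H. \<forall>y \<in> pverts H. x \<noteq> y \<longrightarrow> \<mu> x \<inter> \<mu> y = {}) \<and>
     (\<forall>(x, y) \<in> parcs H. \<exists>u \<in> \<mu> x. \<exists>v \<in> \<mu> y. (u, v) \<in> parcs G)"

text \<open>
  Branch sets are nonempty, since \<^const>\<open>connected\<close> digraphs have at least one vertex.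
\<close>

definition bounded_minor ::
  "nat \<Rightarrow> 'b pair_pre_digraph \<Rightarrow> 'a pair_pre_digraph \<Rightarrow> bool" where
  "bounded_minor m H G \<longleftrightarrow> pair_graph H \<and>
     (\<exists>\<mu>. minor_model \<mu> H G \<and> (\<forall>x \<in> pverts H. card (\<mu> x) \<le> m))"

end

theory Submission
  imports Defs
begin

text \<open>
  Shrink every neighborhood of a vertex of \<open>A\<close> to a set \<open>N a\<close> of size \<open>\<lceil>d\<^sub>0\<rceil>\<close>, and call two vertices of
  \<open>A\<close> conflicting if these sets share at least \<open>\<epsilon>\<^sub>0 d\<^sub>0\<close> vertices. Take a maximum partial assignment
  of vertices of \<open>A\<close> to neighbors in \<open>B\<close> such that every vertex of \<open>B\<close> receives at most \<open>l\<close>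
  pairwise non-conflicting vertices. Since \<open>|A| > l |B|\<close>, some vertex of \<open>A\<close> is unassigned; let
  \<open>R\<close> be the set of vertices reachable from it by alternating paths, where \<open>a\<close> may only be moved to
  a slot \<open>b\<close> in which it has no conflict. By maximality every such \<open>b\<close> carries exactly \<open>l\<close> vertices,
  all of them in \<open>R\<close>.

  If some \<open>a \<in> R\<close> has conflicts in at least \<open>\<epsilon>\<^sub>0 d\<^sub>0 / 2\<close> slots of \<open>N a\<close>, then choosing one
  conflicting vertex from each of them yields, together with \<open>N a\<close>, the dense subgraph. Otherwise
  nearly all of \<open>N a\<close> lies in the set \<open>S\<close> of slots used by \<open>R\<close>, and contracting the stars
  centered at \<open>S\<close> gives the minor: the leaves of a star are pairwise non-conflicting, so each star
  sees about \<open>l d\<^sub>0\<close> other centers, and every edge of the minor is counted at most twice.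
\<close>

section \<open>Conflict-free assignments and augmenting paths\<close>

definition slot_compatible :: "('a \<Rightarrow> 'a \<Rightarrow> bool) \<Rightarrow> ('a \<rightharpoonup> 'b) \<Rightarrow> 'a \<Rightarrow> 'b \<Rightarrow> bool" where
  "slot_compatible conf f a b \<longleftrightarrow> (\<forall>a'. f a' = Some b \<longrightarrow> \<not> conf a a')"

definition conflict_free_assignment ::
  "('a \<Rightarrow> 'b set) \<Rightarrow> ('a \<Rightarrow> 'a \<Rightarrow> bool) \<Rightarrow> nat \<Rightarrow> 'a set \<Rightarrow> ('a \<rightharpoonup> 'b) \<Rightarrow> bool" where
  "conflict_free_assignment N conf l A f \<longleftrightarrow> dom f \<subseteq> A \<and>
     (\<forall>a b. f a = Some b \<longrightarrow> b \<in> N a \<and> slot_compatible conf f a b) \<and>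
     (\<forall>b. card {a. f a = Some b} \<le> l)"

definition free_slot ::
  "('a \<Rightarrow> 'b set) \<Rightarrow> ('a \<Rightarrow> 'a \<Rightarrow> bool) \<Rightarrow> nat \<Rightarrow> ('a \<rightharpoonup> 'b) \<Rightarrow> 'a \<Rightarrow> 'b \<Rightarrow> bool" where
  "free_slot N conf l f a b \<longleftrightarrow>
     b \<in> N a \<and> slot_compatible conf f a b \<and> card {a'. f a' = Some b} < l"

text \<open>\<open>a\<close> must be compatible with every occupant of \<open>b\<close>, including
  the displaced \<open>a'\<close>; hence all occupants of such a slot are one step away from
  \<open>a\<close> simultaneously.\<close>

definition swap_step ::
  "('a \<Rightarrow> 'b set) \<Rightarrow> ('a \<Rightarrow> 'a \<Rightarrow> bool) \<Rightarrow> ('a \<rightharpoonup> 'b) \<Rightarrow> 'a \<Rightarrow> 'a \<Rightarrow> bool" where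
  "swap_step N conf f a a' \<longleftrightarrow> (\<exists>b \<in> N a. f a' = Some b \<and> slot_compatible conf f a b)"

lemma finite_fibre:
  assumes "finite A" "dom f \<subseteq> A"
  shows "finite {a. f a = Some b}"
  by (rule finite_subset[OF _ assms(1)]) (use assms(2) in auto)

text \<open>\<open>a\<close> may be unassigned or already hold another slot; in the latter case the
  update also vacates that slot, so every fibre except that of \<open>b\<close> can only
  shrink.\<close>

lemma assign_free_slot:
  assumes "finite A" and f: "conflict_free_assignment N conf l A f"
    and free: "free_slot N conf l f a b" and "a \<in> A"
    and sym: "\<And>a a'. conf a a' \<Longrightarrow> conf a' a" and irrefl: "\<And>a. \<not> conf a a"
  shows "conflict_free_assignment N conf l A (f(a \<mapsto> b))"
proof -
  have dom: "dom f \<subseteq> A"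
    using f by (simp add: conflict_free_assignment_def)
  have "card {x. (f(a \<mapsto> b)) x = Some c} \<le> l" for c
  proof (cases "c = b")
    case True
    have "card {x. (f(a \<mapsto> b)) x = Some c} \<le> card (insert a {x. f x = Some b})"
      using True finite_fibre[OF assms(1) dom] by (intro card_mono) auto
    also have "\<dots> \<le> l"
      using free by (intro order.trans[OF card_insert_le_m1]) (auto simp: free_slot_def)
    finally show ?thesis .
  next
    case False
    have "card {x. (f(a \<mapsto> b)) x = Some c} \<le> card {x. f x = Some c}"
      using False finite_fibre[OF assms(1) dom] by (intro card_mono) auto
    also have "\<dots> \<le> l"
      using f by (simp add: conflict_free_assignment_def)
    finally show ?thesis .
  qed
  moreover have "c \<in> N x \<and> slot_compatible conf (f(a \<mapsto> b)) x c" if "(f(a \<mapsto> b)) x = Some c" for x c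
    using that f free sym irrefl
    by (auto simp: conflict_free_assignment_def slot_compatible_def free_slot_def split: if_splits)
  ultimately show ?thesis
    using dom \<open>a \<in> A\<close> by (auto simp: conflict_free_assignment_def)
qed

text \<open>The augmenting path argument. A shortest path from an unassigned vertex to a free slot can be
  shortened further by moving its last vertex to that slot: this vacates a slot for its
  predecessor, and the other steps survive since no earlier vertex on the path sees a free slot.\<close>

lemma no_augmenting_path:
  assumes "finite A" and f: "conflict_free_assignment N conf l A f"
    and max: "\<And>g. conflict_free_assignment N conf l A g \<Longrightarrow> card (dom g) \<le> card (dom f)"
    and "a\<^sub>0 \<in> A" "a\<^sub>0 \<notin> dom f"
    and sym: "\<And>a a'. conf a a' \<Longrightarrow> conf a' a" and irrefl: "\<And>a. \<not> conf a a"
    and reach: "(swap_step N conf f)\<^sup>*\<^sup>* a\<^sub>0 a"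
  shows "\<not> free_slot N conf l f a b"
proof
  assume free: "free_slot N conf l f a b"
  \<comment> \<open>The assignment \<open>g\<close> varies together with the path, because
    shortening alters it. Fixing its domain keeps \<open>a\<^sub>0\<close> unassigned and the
    maximality of \<open>f\<close> applicable.\<close>
  define aug where "aug n \<longleftrightarrow> (\<exists>g p c. conflict_free_assignment N conf l A g \<and> dom g = dom f \<and>
     p 0 = a\<^sub>0 \<and> (\<forall>i<n. swap_step N conf g (p i) (p (Suc i))) \<and> free_slot N conf l g (p n) c)" for n
  have "\<exists>n. aug n"
  proof -
    obtain n p where "p 0 = a\<^sub>0" "p n = a" "\<forall>i<n. swap_step N conf f (p i) (p (Suc i))"
      using reach by (metis rtranclp_imp_relpowp relpowp_fun_conv)
    then show ?thesis
      unfolding aug_def using f free by blast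
  qed
  define n where "n = (LEAST n. aug n)"
  have "aug n" and least: "\<And>m. aug m \<Longrightarrow> n \<le> m"
    unfolding n_def using \<open>\<exists>n. aug n\<close> by (auto intro: LeastI_ex Least_le)
  then obtain g p c where g: "conflict_free_assignment N conf l A g" and dom: "dom g = dom f"
    and p: "p 0 = a\<^sub>0" "\<And>i. i < n \<Longrightarrow> swap_step N conf g (p i) (p (Suc i))"
    and c: "free_slot N conf l g (p n) c"
    unfolding aug_def by blast
  have domA: "dom f \<subseteq> A"
    using f by (simp add: conflict_free_assignment_def)
  show False
  proof (cases n)
    case 0
    have "conflict_free_assignment N conf l A (g(a\<^sub>0 \<mapsto> c))"
      using assign_free_slot[OF \<open>finite A\<close> g _ \<open>a\<^sub>0 \<in> A\<close> sym irrefl] c p(1) 0 by simp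
    then have "card (insert a\<^sub>0 (dom f)) \<le> card (dom f)"
      using max[of "g(a\<^sub>0 \<mapsto> c)"] dom by simp
    then show False
      using \<open>a\<^sub>0 \<notin> dom f\<close> finite_subset[OF domA \<open>finite A\<close>] by simp
  next
    case (Suc m)
    obtain d where d: "d \<in> N (p m)" "g (p n) = Some d" "slot_compatible conf g (p m) d"
      using p(2)[of m] Suc by (auto simp: swap_step_def)
    then have "p n \<in> A"
      using dom domA by auto
    define h where "h = g(p n \<mapsto> c)"
    have h: "conflict_free_assignment N conf l A h"
      unfolding h_def by (rule assign_free_slot[OF \<open>finite A\<close> g c \<open>p n \<in> A\<close> sym irrefl])
    have nofree: "\<not> free_slot N conf l g (p i) x" if "i < n" for i x
    proof
      assume "free_slot N conf l g (p i) x"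
      then have "aug i"
        unfolding aug_def using g dom p that by (metis order.strict_trans)
      then show False
        using least that by fastforce
    qed
    \<comment> \<open>Otherwise \<open>c\<close> would already be free for \<open>p m\<close>,
      against the minimality of \<open>n\<close>. The same reason excludes \<open>e = c\<close> and
      \<open>p (Suc i) = p n\<close> below.\<close>
    have "d \<noteq> c"
      using d nofree[of m c] c Suc by (auto simp: free_slot_def)
    have hsub: "{x. h x = Some y} \<subseteq> {x. g x = Some y}" if "y \<noteq> c" for y
      using that by (auto simp: h_def)
    have "swap_step N conf h (p i) (p (Suc i))" if i: "i < m" for i
    proof -
      obtain e where e: "e \<in> N (p i)" "g (p (Suc i)) = Some e" "slot_compatible conf g (p i) e"
        using p(2)[of i] Suc i by (auto simp: swap_step_def)
      have "e \<noteq> c"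
        using e nofree[of i c] c Suc i by (auto simp: free_slot_def)
      have "p (Suc i) \<noteq> p n"
        using nofree[of "Suc i" c] c Suc i by auto
      then have "h (p (Suc i)) = Some e"
        using e by (simp add: h_def)
      moreover have "slot_compatible conf h (p i) e"
        using e(3) hsub[OF \<open>e \<noteq> c\<close>] by (auto simp: slot_compatible_def)
      ultimately show ?thesis
        using e(1) by (auto simp: swap_step_def)
    qed
    moreover have "free_slot N conf l h (p m) d"
    proof -
      have "{x. h x = Some d} \<subset> {x. g x = Some d}"
        using \<open>d \<noteq> c\<close> d(2) by (auto simp: h_def)
      then have "card {x. h x = Some d} < card {x. g x = Some d}"
        using finite_fibre[OF \<open>finite A\<close>] dom domA by (metis psubset_card_mono)
      also have "\<dots> \<le> l"
        using g by (simp add: conflict_free_assignment_def)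
      finally show ?thesis
        using d hsub[OF \<open>d \<noteq> c\<close>] by (auto simp: free_slot_def slot_compatible_def)
    qed
    moreover have "dom h = dom f"
      using d(2) dom by (auto simp: h_def)
    ultimately have "aug m"
      unfolding aug_def using h p(1) by blast
    then show False
      using least Suc by fastforce
  qed
qed

text \<open>In a maximum assignment no vertex reachable from an unassigned one sees a free slot. So
  each slot compatible with a reachable vertex holds exactly \<open>l\<close> vertices, all
  reachable; as \<open>l\<close> is positive, it has an occupant in \<open>R\<close>.\<close>

lemma closed_conflict_free_assignment:
  fixes N :: "'a \<Rightarrow> 'b set"
  assumes "finite A" "finite B" "\<And>a. a \<in> A \<Longrightarrow> N a \<subseteq> B" "l * card B < card A" "0 < l"
    and sym: "\<And>a a'. conf a a' \<Longrightarrow> conf a' a" and irrefl: "\<And>a. \<not> conf a a"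
  obtains f R where "conflict_free_assignment N conf l A f" "R \<subseteq> A" "R \<noteq> {}"
    "\<And>a b. a \<in> R \<Longrightarrow> f a = Some b \<Longrightarrow> card {a. f a = Some b} = l \<and> {a. f a = Some b} \<subseteq> R"
    "\<And>a b. a \<in> R \<Longrightarrow> b \<in> N a \<Longrightarrow> slot_compatible conf f a b \<Longrightarrow> \<exists>a' \<in> R. f a' = Some b"
proof -
  have "conflict_free_assignment N conf l A Map.empty"
    by (auto simp: conflict_free_assignment_def)
  moreover have "card (dom g) < Suc (card A)" if "conflict_free_assignment N conf l A g" for g
    using that card_mono[OF \<open>finite A\<close>, of "dom g"] by (auto simp: conflict_free_assignment_def)
  ultimately obtain f where f: "conflict_free_assignment N conf l A f"
    and max: "\<And>g. conflict_free_assignment N conf l A g \<Longrightarrow> card (dom g) \<le> card (dom f)"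
    using ex_has_greatest_nat[of "conflict_free_assignment N conf l A" _ "\<lambda>g. card (dom g)" "Suc (card A)"]
    by blast
  have domA: "dom f \<subseteq> A"
    using f by (simp add: conflict_free_assignment_def)
  \<comment> \<open>Pigeonhole: the slots in \<open>B\<close> hold at most \<open>l * card B\<close>
    vertices together, too few for all of \<open>A\<close>.\<close>
  have "dom f \<subseteq> (\<Union>b\<in>B. {a. f a = Some b})"
    using f assms(3) domA by (fastforce simp: conflict_free_assignment_def)
  then have "card (dom f) \<le> card (\<Union>b\<in>B. {a. f a = Some b})"
    using assms(2) finite_fibre[OF assms(1) domA] by (intro card_mono) auto
  also have "\<dots> \<le> (\<Sum>b\<in>B. card {a. f a = Some b})"
    by (rule card_UN_le[OF assms(2)])
  also have "\<dots> \<le> card B * l"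
    using sum_bounded_above[of B "\<lambda>b. card {a. f a = Some b}" l] f
    by (simp add: conflict_free_assignment_def)
  finally have "card (dom f) < card A"
    using assms(4) by (simp add: mult.commute)
  then obtain a\<^sub>0 where a0: "a\<^sub>0 \<in> A" "a\<^sub>0 \<notin> dom f"
    using domA by (metis less_irrefl subsetI subset_antisym)
  define R where "R = {a. (swap_step N conf f)\<^sup>*\<^sup>* a\<^sub>0 a}"
  have nofree: "\<not> free_slot N conf l f a b" if "a \<in> R" for a b
    using no_augmenting_path[OF assms(1) f max a0 sym irrefl] that by (simp add: R_def)
  have full: "card {a. f a = Some b} = l \<and> {a. f a = Some b} \<subseteq> R"
    if "a \<in> R" "b \<in> N a" "slot_compatible conf f a b" for a b
  proof
    have "card {a. f a = Some b} \<ge> l"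
      using nofree[OF that(1), of b] that by (auto simp: free_slot_def)
    then show "card {a. f a = Some b} = l"
      using f by (simp add: conflict_free_assignment_def le_antisym)
    show "{a. f a = Some b} \<subseteq> R"
    proof
      fix a' assume "a' \<in> {a. f a = Some b}"
      then have "swap_step N conf f a a'"
        using that by (auto simp: swap_step_def)
      then show "a' \<in> R"
        using that(1) by (simp add: R_def)
    qed
  qed
  show ?thesis
  proof (rule that[OF f])
    show "R \<noteq> {}"
      by (auto simp: R_def)
    show "R \<subseteq> A"
    proof
      fix a assume "a \<in> R"
      then have "(swap_step N conf f)\<^sup>*\<^sup>* a\<^sub>0 a"
        by (simp add: R_def)
      \<comment> \<open>Only the last step of the path matters: its target is assigned, hence in
        \<open>dom f\<close>.\<close>
      then show "a \<in> A"
        by cases (use a0 domA in \<open>auto simp: swap_step_def\<close>)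
    qed
    \<comment> \<open>A slot held by \<open>a\<close> is compatible with \<open>a\<close>, since
      \<open>f\<close> is conflict-free, so \<open>full\<close> covers it.\<close>
    show "card {a. f a = Some b} = l \<and> {a. f a = Some b} \<subseteq> R" if "a \<in> R" "f a = Some b" for a b
      using full[OF that(1)] that(2) f by (auto simp: conflict_free_assignment_def)
    show "\<exists>a' \<in> R. f a' = Some b" if "a \<in> R" "b \<in> N a" "slot_compatible conf f a b" for a b
    proof -
      have "{a. f a = Some b} \<noteq> {}"
        using full[OF that] \<open>0 < l\<close> by (metis card.empty less_irrefl)
      then show ?thesis
        using full[OF that] by blast
    qed
  qed
qed

section \<open>Subgraphs, star minors and edge counts\<close>

lemma pair_graphI:
  assumes "finite V" "E \<subseteq> V \<times> V" "\<And>u v. (u, v) \<in> E \<Longrightarrow> (v, u) \<in> E" "\<And>u. (u, u) \<notin> E"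
  shows "pair_graph \<lparr>pverts = V, parcs = E\<rparr>"
proof
  show "finite (parcs \<lparr>pverts = V, parcs = E\<rparr>)"
    using finite_subset[OF assms(2)] assms(1) by simp
qed (use assms in \<open>auto simp: symmetric_def intro!: symI\<close>)

text \<open>\<open>connected\<close> means strong connectivity of the symmetric closure, which
  supplies the arcs leading back from \<open>b\<close>; any two vertices are then joined through
  \<open>b\<close>.\<close>

lemma connected_star:
  assumes "\<And>a. a \<in> F \<Longrightarrow> (a, b) \<in> parcs G"
  shows "connected (with_proj G \<restriction> insert b F)"
proof -
  let ?M = "mk_symmetric (with_proj G \<restriction> insert b F)"
  have arcs: "(a, b) \<in> parcs ?M" "(b, a) \<in> parcs ?M" if "a \<in> F" for a
    using that assms by (force simp: parcs_mk_symmetric induce_subgraph_def)+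
  have "u \<rightarrow>\<^sup>*\<^bsub>?M\<^esub> v" if "u \<in> insert b F" "v \<in> insert b F" for u v
  proof -
    have b: "(u, b) \<in> rtrancl_on (insert b F) (parcs ?M)"
      using that(1) arcs by (cases "u = b") (auto intro: rtrancl_on.intros)
    have "(u, v) \<in> rtrancl_on (insert b F) (parcs ?M)"
      using that(2) b arcs by (cases "v = b") (auto intro: rtrancl_on.intros)
    then show ?thesis
      by (simp add: reachable_def)
  qed
  then show ?thesis
    by (auto simp: connected_def)
qed

lemma finite_uedges:
  assumes "finite (parcs H)"
  shows "finite (uedges H)"
proof -
  have "uedges H = (\<lambda>(u, v). {u, v}) ` parcs H"
    by (auto simp: uedges_def)
  then show ?thesis
    using assms by simp
qed

lemma card_parcs_le_uedges:
  assumes "finite (parcs H)"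
  shows "card (parcs H) \<le> 2 * card (uedges H)"
proof -
  have sub: "{(x, y). {x, y} = {u, v}} \<subseteq> {(u, v), (v, u)}" for u v :: 'a
    by (auto simp: doubleton_eq_iff)
  have pairs: "finite {(x, y). {x, y} = e} \<and> card {(x, y). {x, y} = e} \<le> 2" if "e \<in> uedges H" for e
  proof -
    obtain u v where "e = {u, v}"
      using \<open>e \<in> uedges H\<close> by (auto simp: uedges_def)
    then show ?thesis
      using finite_subset[OF sub[of u v]] card_mono[OF _ sub[of u v]] card_insert_le_m1[of 2 "{(v, u)}" "(u, v)"]
      by auto
  qed
  have "parcs H \<subseteq> (\<Union>e\<in>uedges H. {(x, y). {x, y} = e})"
    by (auto simp: uedges_def)
  then have "card (parcs H) \<le> card (\<Union>e\<in>uedges H. {(x, y). {x, y} = e})"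
    using pairs finite_uedges[OF assms] by (intro card_mono) auto
  also have "\<dots> \<le> (\<Sum>e\<in>uedges H. card {(x, y). {x, y} = e})"
    by (rule card_UN_le[OF finite_uedges[OF assms]])
  also have "\<dots> \<le> card (uedges H) * 2"
    using sum_bounded_above[of "uedges H" "\<lambda>e. card {(x, y). {x, y} = e}" 2] pairs by simp
  finally show ?thesis
    by simp
qed

text \<open>The private parts \<open>P a\<close>, obtained from \<open>M a\<close> by removing its
  overlaps with the other sets, are pairwise disjoint, and each loses at most \<open>t\<close> per
  other index.\<close>

lemma card_UN_almost_disjoint:
  fixes M :: "'a \<Rightarrow> 'b set" and m t :: real
  assumes "finite F" "\<And>a. a \<in> F \<Longrightarrow> finite (M a)" "\<And>a. a \<in> F \<Longrightarrow> m \<le> card (M a)"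
    and "\<And>a a'. a \<in> F \<Longrightarrow> a' \<in> F \<Longrightarrow> a \<noteq> a' \<Longrightarrow> card (M a \<inter> M a') \<le> t"
  shows "card F * (m - (real (card F) - 1) * t) \<le> card (\<Union>a\<in>F. M a)"
proof -
  define P where "P a = M a - (\<Union>a'\<in>F - {a}. M a \<inter> M a')" for a
  have P: "m - (real (card F) - 1) * t \<le> card (P a)" if "a \<in> F" for a
  proof -
    have "real (card (\<Union>a'\<in>F - {a}. M a \<inter> M a')) \<le> (\<Sum>a'\<in>F - {a}. real (card (M a \<inter> M a')))"
      using card_UN_le[of "F - {a}" "\<lambda>a'. M a \<inter> M a'"] \<open>finite F\<close>
      by (metis finite_Diff of_nat_mono of_nat_sum)
    also have "\<dots> \<le> real (card (F - {a})) * t"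
      using assms(4) that by (intro sum_bounded_above) auto
    also have "real (card (F - {a})) = real (card F) - 1"
      using that \<open>finite F\<close> by (metis card_Suc_Diff1 of_nat_Suc add_diff_cancel_left')
    finally have "real (card (\<Union>a'\<in>F - {a}. M a \<inter> M a')) \<le> (real (card F) - 1) * t" .
    moreover have "(\<Union>a'\<in>F - {a}. M a \<inter> M a') \<subseteq> M a"
      by auto
    then have "real (card (P a)) = real (card (M a)) - card (\<Union>a'\<in>F - {a}. M a \<inter> M a')"
      unfolding P_def using assms(2)[OF that]
      by (metis card_Diff_subset card_mono finite_subset of_nat_diff)
    ultimately show ?thesis
      using assms(3)[OF that] by linarith
  qed
  have "card F * (m - (real (card F) - 1) * t) \<le> (\<Sum>a\<in>F. real (card (P a)))"
    using P by (intro sum_bounded_below)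
  also have "\<dots> = card (\<Union>a\<in>F. P a)"
    using assms(1,2) by (subst card_UN_disjoint) (auto simp: P_def)
  also have "\<dots> \<le> card (\<Union>a\<in>F. M a)"
    using assms(1,2) by (intro of_nat_mono card_mono) (auto simp: P_def)
  finally show ?thesis .
qed

lemma bipartite_subgraph_with_many_edges:
  fixes k :: real
  assumes "pair_graph G" "bipartition G A B" "F \<subseteq> A" "S \<subseteq> B"
    and nbrs: "\<And>a. a \<in> F \<Longrightarrow> k \<le> card {b \<in> S. (a, b) \<in> parcs G}"
  shows "\<exists>H. pair_graph H \<and> subgraph (with_proj H) (with_proj G) \<and>
    card (pverts H) \<le> card F + card S \<and> card F * k \<le> card (uedges H)"
proof -
  interpret G: pair_graph G by fact
  have AB: "pverts G = A \<union> B" "A \<inter> B = {}"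
    using assms(2) by (auto simp: bipartition_def)
  have FS: "F \<inter> S = {}"
    using AB assms(3,4) by auto
  have fin: "finite F" "finite S"
    using AB assms(3,4) G.pair_finite_verts by (auto intro: finite_subset)
  define E where "E = {(u, v) \<in> parcs G. u \<in> F \<and> v \<in> S \<or> u \<in> S \<and> v \<in> F}"
  define H where "H = \<lparr>pverts = F \<union> S, parcs = E\<rparr>"
  have sym: "(v, u) \<in> parcs G" if "(u, v) \<in> parcs G" for u v
    using G.pair_sym_arcs that by (auto simp: symmetric_def dest: symD)
  have H: "pair_graph H"
    unfolding H_def using fin FS sym by (intro pair_graphI) (auto simp: E_def)
  interpret H: pair_graph H by fact
  have "subgraph (with_proj H) (with_proj G)"
    using AB assms(3,4) H.wf_digraph_axioms G.wf_digraph_axioms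
    by (auto simp: subgraph_def compatible_def H_def E_def)
  moreover have "card (pverts H) \<le> card F + card S"
    by (simp add: H_def card_Un_le)
  moreover have "card F * k \<le> card (uedges H)"
  proof -
    let ?P = "SIGMA a:F. {b \<in> S. (a, b) \<in> parcs G}"
    have "card F * k \<le> (\<Sum>a\<in>F. real (card {b \<in> S. (a, b) \<in> parcs G}))"
      using nbrs by (intro sum_bounded_below)
    also have "\<dots> = card ?P"
      using fin by simp
    \<comment> \<open>Disjointness of \<open>F\<close> and \<open>S\<close> makes each edge arise
      once, from its endpoint in \<open>F\<close>.\<close>
    also have "card ?P = card ((\<lambda>(a, b). {a, b}) ` ?P)"
      using FS by (intro card_image[symmetric] inj_onI) (auto simp: doubleton_eq_iff)
    also have "real \<dots> \<le> card (uedges H)"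
      using finite_uedges[OF H.pair_finite_arcs]
      by (intro of_nat_mono card_mono) (auto simp: uedges_def H_def E_def)
    finally show ?thesis .
  qed
  ultimately show ?thesis
    using H by blast
qed

text \<open>Contract each star with center \<open>b\<close> and leaves \<open>F b\<close>, keeping
  the centers as vertices of the minor. \<open>T b\<close> consists of other centers seen by the
  leaves of \<open>b\<close>. An edge may be counted from both ends, whence
  \<open>k / 2\<close>.\<close>

lemma bounded_minor_of_stars:
  fixes G :: "'a pair_pre_digraph" and k :: real
  assumes "pair_graph G" "bipartition G A B" "S \<subseteq> B" "S \<noteq> {}"
    and F: "\<And>b. b \<in> S \<Longrightarrow> F b \<subseteq> A" "\<And>b. b \<in> S \<Longrightarrow> card (F b) \<le> l"
      "\<And>a b. b \<in> S \<Longrightarrow> a \<in> F b \<Longrightarrow> (a, b) \<in> parcs G"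
      "\<And>b b'. b \<in> S \<Longrightarrow> b' \<in> S \<Longrightarrow> b \<noteq> b' \<Longrightarrow> F b \<inter> F b' = {}"
    and T: "\<And>b. b \<in> S \<Longrightarrow> T b \<subseteq> S - {b}"
      "\<And>b c. b \<in> S \<Longrightarrow> c \<in> T b \<Longrightarrow> \<exists>a \<in> F b. (a, c) \<in> parcs G"
      "\<And>b. b \<in> S \<Longrightarrow> k \<le> card (T b)"
  shows "\<exists>G' :: 'a pair_pre_digraph. bounded_minor (l + 1) G' G \<and> k / 2 \<le> density G'"
proof -
  interpret G: pair_graph G by fact
  have AB: "pverts G = A \<union> B" "A \<inter> B = {}"
    using assms(2) by (auto simp: bipartition_def)
  have fin: "finite S"
    using AB assms(3) G.pair_finite_verts by (auto intro: finite_subset)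
  have sym: "(v, u) \<in> parcs G" if "(u, v) \<in> parcs G" for u v
    using G.pair_sym_arcs that by (auto simp: symmetric_def dest: symD)
  \<comment> \<open>\<open>c \<in> T b\<close> need not give \<open>b \<in> T c\<close>, so the
    relation is symmetrized.\<close>
  define E where "E = (SIGMA b:S. T b) \<union> (SIGMA b:S. T b)\<inverse>"
  define G' where "G' = \<lparr>pverts = S, parcs = E\<rparr>"
  have G': "pair_graph G'"
    unfolding G'_def using fin T(1) by (intro pair_graphI) (auto simp: E_def)
  interpret G': pair_graph G' by fact
  define \<mu> where "\<mu> b = insert b (F b)" for b
  have "minor_model \<mu> G' G"
    unfolding minor_model_def
  proof (intro conjI ballI impI)
    fix b assume "b \<in> pverts G'"
    then have b: "b \<in> S"
      by (simp add: G'_def)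
    then show "\<mu> b \<subseteq> pverts G"
      using AB F(1) assms(3) by (auto simp: \<mu>_def)
    show "connected (with_proj G \<restriction> \<mu> b)"
      unfolding \<mu>_def using F(3)[OF b] by (rule connected_star)
  next
    fix b c assume "b \<in> pverts G'" "c \<in> pverts G'" "b \<noteq> c"
    then have bc: "b \<in> S" "c \<in> S"
      by (simp_all add: G'_def)
    then show "\<mu> b \<inter> \<mu> c = {}"
      using F(1)[of b] F(1)[of c] F(4)[OF bc \<open>b \<noteq> c\<close>] \<open>b \<noteq> c\<close> AB(2) assms(3)
      by (auto simp: \<mu>_def)
  next
    have "\<exists>u\<in>\<mu> b. \<exists>v\<in>\<mu> c. (u, v) \<in> parcs G \<and> (v, u) \<in> parcs G" if "b \<in> S" "c \<in> T b" for b c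
      using T(2)[OF that] sym by (auto simp: \<mu>_def)
    then show "case e of (b, c) \<Rightarrow> \<exists>u\<in>\<mu> b. \<exists>v\<in>\<mu> c. (u, v) \<in> parcs G" if "e \<in> parcs G'" for e
      using that unfolding G'_def E_def by fastforce
  qed
  moreover have "card (\<mu> b) \<le> l + 1" if "b \<in> pverts G'" for b
    using F(2)[of b] that card_insert_le_m1[of "l + 1" "F b" b] by (simp add: \<mu>_def G'_def)
  ultimately have "bounded_minor (l + 1) G' G"
    using G' by (auto simp: bounded_minor_def)
  moreover have "k / 2 \<le> density G'"
  proof -
    have "card S * k \<le> (\<Sum>b\<in>S. real (card (T b)))"
      using T(3) by (intro sum_bounded_below)
    also have "\<dots> = card (SIGMA b:S. T b)"
      using fin T(1) by (subst card_SigmaI) (auto intro: finite_subset)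
    also have "\<dots> \<le> card (parcs G')"
      using G'.pair_finite_arcs by (intro of_nat_mono card_mono) (auto simp: G'_def E_def)
    also have "\<dots> \<le> 2 * real (card (uedges G'))"
      using card_parcs_le_uedges[OF G'.pair_finite_arcs] by linarith
    finally show ?thesis
      using \<open>S \<noteq> {}\<close> fin by (simp add: density_def G'_def field_simps card_gt_0_iff)
  qed
  ultimately show ?thesis
    by blast
qed

section \<open>The dichotomy between many and few conflicts\<close>

theorem theorem4p2:
  fixes l :: nat and \<epsilon>\<^sub>0 d\<^sub>0 :: real
    and G :: "'a pair_pre_digraph" and A B :: "'a set"
  assumes "l \<ge> 2"
    and "0 < \<epsilon>\<^sub>0" and "\<epsilon>\<^sub>0 < 1 / (2 * real l)"
    and "d\<^sub>0 \<ge> 1 / \<epsilon>\<^sub>0"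
    and "pair_graph G" and "bipartition G A B"
    and "card A > l * card B"
    and "\<forall>a \<in> A. real (card {b \<in> B. (a, b) \<in> parcs G}) \<ge> d\<^sub>0"
  shows "(\<exists>H :: 'a pair_pre_digraph. pair_graph H \<and> subgraph (with_proj H) (with_proj G) \<and>
            real (card (pverts H)) \<le> 3 * d\<^sub>0 \<and>
            real (card (uedges H)) \<ge> \<epsilon>\<^sub>0\<^sup>2 * d\<^sub>0\<^sup>2 / 2) \<or>
         (\<exists>G' :: 'a pair_pre_digraph. bounded_minor (l + 1) G' G \<and>
            density G' \<ge> real l / 2 * (1 - 2 * real l * \<epsilon>\<^sub>0) * d\<^sub>0)"
proof (rule disjCI)
  assume no_minor: "\<not> (\<exists>G' :: 'a pair_pre_digraph. bounded_minor (l + 1) G' G \<and>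
            density G' \<ge> real l / 2 * (1 - 2 * real l * \<epsilon>\<^sub>0) * d\<^sub>0)"
  interpret G: pair_graph G by fact
  have AB: "pverts G = A \<union> B" "A \<inter> B = {}"
    using \<open>bipartition G A B\<close> by (auto simp: bipartition_def)
  have fin: "finite A" "finite B"
    using AB G.pair_finite_verts by auto
  have "2 * real l < 1 / \<epsilon>\<^sub>0"
    using assms(1-3) by (simp add: field_simps)
  \<comment> \<open>This absorbs the rounding of \<open>d\<^sub>0\<close> to \<open>D\<close> when
    the vertices of the dense subgraph are counted.\<close>
  then have "4 < d\<^sub>0"
    using assms(1,4) by linarith
  \<comment> \<open>This pays for the single vertex lost when a center is removed from its own
    neighborhood.\<close>
  have "1 \<le> \<epsilon>\<^sub>0 * d\<^sub>0"
    using assms(2,4) by (simp add: field_simps)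
  have "\<epsilon>\<^sub>0 < 1"
  proof -
    have "1 / (2 * real l) < 1"
      using assms(1) by simp
    then show ?thesis
      using assms(3) by linarith
  qed
  define D where "D = nat \<lceil>d\<^sub>0\<rceil>"
  have D: "d\<^sub>0 \<le> D" "D < d\<^sub>0 + 1"
    using \<open>4 < d\<^sub>0\<close> unfolding D_def by linarith+
  have "\<exists>S \<subseteq> {b \<in> B. (a, b) \<in> parcs G}. card S = D" if "a \<in> A" for a
  proof -
    have "D \<le> card {b \<in> B. (a, b) \<in> parcs G}"
      using assms(8) D(2) that by fastforce
    then show ?thesis
      by (meson obtain_subset_with_card_n)
  qed
  then obtain N where N: "\<And>a. a \<in> A \<Longrightarrow> N a \<subseteq> {b \<in> B. (a, b) \<in> parcs G}"
    and cardN: "\<And>a. a \<in> A \<Longrightarrow> card (N a) = D"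
    by metis
  have finN: "finite (N a)" if "a \<in> A" for a
    using N[OF that] fin by (auto intro: finite_subset)
  \<comment> \<open>Irreflexivity matters: \<open>slot_compatible\<close> also tests a vertex
    against the slot it holds.\<close>
  define conf where "conf a a' \<longleftrightarrow> a \<noteq> a' \<and> \<epsilon>\<^sub>0 * d\<^sub>0 \<le> card (N a \<inter> N a')" for a a'
  obtain f R where f: "conflict_free_assignment N conf l A f" and R: "R \<subseteq> A" "R \<noteq> {}"
    and full: "\<And>a b. a \<in> R \<Longrightarrow> f a = Some b \<Longrightarrow>
      card {a. f a = Some b} = l \<and> {a. f a = Some b} \<subseteq> R"
    and closed: "\<And>a b. a \<in> R \<Longrightarrow> b \<in> N a \<Longrightarrow> slot_compatible conf f a b \<Longrightarrow>
      \<exists>a' \<in> R. f a' = Some b"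
  proof (rule closed_conflict_free_assignment[of A B N l conf])
    show "N a \<subseteq> B" if "a \<in> A" for a
      using N[OF that] by auto
  qed (use fin assms(1,7) in \<open>auto simp: conf_def Int_commute\<close>)
  have fA: "a \<in> A" "b \<in> N a" "slot_compatible conf f a b" if "f a = Some b" for a b
    using f that by (auto simp: conflict_free_assignment_def)
  define C where "C a = {b \<in> N a. \<not> slot_compatible conf f a b}" for a
  define F where "F b = {a. f a = Some b}" for b
  define S where "S = {b. \<exists>a \<in> R. f a = Some b}"
  have "\<exists>a \<in> R. \<epsilon>\<^sub>0 * d\<^sub>0 / 2 \<le> card (C a)"
  proof (rule ccontr)
    assume "\<not> ?thesis"
    then have small: "card (C a) < \<epsilon>\<^sub>0 * d\<^sub>0 / 2" if "a \<in> R" for a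
      using that by force
    have NS: "d\<^sub>0 - \<epsilon>\<^sub>0 * d\<^sub>0 / 2 \<le> card (N a \<inter> S)" if "a \<in> R" for a
    proof -
      have a: "a \<in> A"
        using that R by auto
      \<comment> \<open>By closure of \<open>R\<close>, a slot of \<open>N a\<close> without
        conflict is held by a member of \<open>R\<close>.\<close>
      have "N a \<subseteq> C a \<union> (N a \<inter> S)"
        using closed[OF that] by (auto simp: C_def S_def)
      then have "card (N a) \<le> card (C a \<union> (N a \<inter> S))"
        using finN[OF a] by (intro card_mono) (auto simp: C_def)
      also have "\<dots> \<le> card (C a) + card (N a \<inter> S)"
        by (rule card_Un_le)
      finally show ?thesis
        using small[OF that] cardN[OF a] D by linarith
    qed
    define T where "T b = (\<Union>a\<in>F b. N a \<inter> S - {b})" for b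
    \<comment> \<open>Each of the \<open>l\<close> leaves contributes its part of
      \<open>N a \<inter> S\<close>, minus 1 for the center \<open>b\<close>, minus at most
      \<open>\<epsilon>\<^sub>0 * d\<^sub>0\<close> for the overlap with each of the
      \<open>l - 1\<close> other leaves.\<close>
    define k where "k = l * (d\<^sub>0 - \<epsilon>\<^sub>0 * d\<^sub>0 / 2 - 1 - (real l - 1) * (\<epsilon>\<^sub>0 * d\<^sub>0))"
    have S: "card (F b) = l \<and> F b \<subseteq> R" if "b \<in> S" for b
      using that full unfolding S_def F_def by blast
    have "\<exists>G' :: 'a pair_pre_digraph. bounded_minor (l + 1) G' G \<and> k / 2 \<le> density G'"
    proof (rule bounded_minor_of_stars[OF \<open>pair_graph G\<close> \<open>bipartition G A B\<close>])
      show "S \<subseteq> B"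
        using fA N by (fastforce simp: S_def)
      obtain a where "a \<in> R"
        using R by auto
      moreover have "\<epsilon>\<^sub>0 * d\<^sub>0 / 2 < d\<^sub>0"
        using \<open>\<epsilon>\<^sub>0 < 1\<close> \<open>4 < d\<^sub>0\<close> by (simp add: field_simps)
      ultimately show "S \<noteq> {}"
        using NS[of a] by auto
      fix b assume b: "b \<in> S"
      show "F b \<subseteq> A"
        using S[OF b] R by auto
      show "card (F b) \<le> l"
        using S[OF b] by simp
      show "(a, b) \<in> parcs G" if "a \<in> F b" for a
        using that fA N by (fastforce simp: F_def)
      show "F b \<inter> F b' = {}" if "b \<noteq> b'" for b'
        using that by (auto simp: F_def)
      show "T b \<subseteq> S - {b}"
        by (auto simp: T_def)
      show "\<exists>a \<in> F b. (a, c) \<in> parcs G" if "c \<in> T b" for c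
        using that \<open>F b \<subseteq> A\<close> N by (fastforce simp: T_def)
      have "card (F b) * (d\<^sub>0 - \<epsilon>\<^sub>0 * d\<^sub>0 / 2 - 1 - (real (card (F b)) - 1) * (\<epsilon>\<^sub>0 * d\<^sub>0)) \<le> card (T b)"
        unfolding T_def
      proof (rule card_UN_almost_disjoint)
        show "finite (F b)"
          using \<open>F b \<subseteq> A\<close> fin finite_subset by blast
        fix a assume a: "a \<in> F b"
        then have "a \<in> R" "a \<in> A"
          using S[OF b] R by auto
        then show "finite (N a \<inter> S - {b})"
          using finN by simp
        have "card (N a \<inter> S) - 1 \<le> card (N a \<inter> S - {b})"
          using diff_card_le_card_Diff[of "{b}" "N a \<inter> S"] by simp
        then show "d\<^sub>0 - \<epsilon>\<^sub>0 * d\<^sub>0 / 2 - 1 \<le> card (N a \<inter> S - {b})"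
          using NS[OF \<open>a \<in> R\<close>] by linarith
        fix a' assume a': "a' \<in> F b" "a \<noteq> a'"
        have "card ((N a \<inter> S - {b}) \<inter> (N a' \<inter> S - {b})) \<le> card (N a \<inter> N a')"
          using finN[OF \<open>a \<in> A\<close>] by (intro card_mono) auto
        \<comment> \<open>Both leaves occupy slot \<open>b\<close> of a conflict-free assignment, so
          their overlap lies below the threshold.\<close>
        moreover have "\<not> conf a a'"
          using a a' fA(3)[of a b] by (auto simp: F_def slot_compatible_def)
        ultimately show "card ((N a \<inter> S - {b}) \<inter> (N a' \<inter> S - {b})) \<le> \<epsilon>\<^sub>0 * d\<^sub>0"
          using \<open>a \<noteq> a'\<close> by (simp add: conf_def)
      qed
      then show "k \<le> card (T b)"
        using S[OF b] by (simp add: k_def)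
    qed
    moreover have "real l / 2 * (1 - 2 * real l * \<epsilon>\<^sub>0) * d\<^sub>0 \<le> k / 2"
    proof -
      \<comment> \<open>The loss per leaf is at most
        \<open>(l + 1/2) * \<epsilon>\<^sub>0 * d\<^sub>0\<close>, using
        \<open>1 \<le> \<epsilon>\<^sub>0 * d\<^sub>0\<close>; this is within the allowed
        \<open>2 * l * \<epsilon>\<^sub>0 * d\<^sub>0\<close>.\<close>
      have "3 / 2 * (\<epsilon>\<^sub>0 * d\<^sub>0) \<le> real l * (\<epsilon>\<^sub>0 * d\<^sub>0)"
        using assms(1) \<open>1 \<le> \<epsilon>\<^sub>0 * d\<^sub>0\<close> by (intro mult_right_mono) auto
      then have "(1 - 2 * real l * \<epsilon>\<^sub>0) * d\<^sub>0 \<le>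
          d\<^sub>0 - \<epsilon>\<^sub>0 * d\<^sub>0 / 2 - 1 - (real l - 1) * (\<epsilon>\<^sub>0 * d\<^sub>0)"
        using \<open>1 \<le> \<epsilon>\<^sub>0 * d\<^sub>0\<close> by (simp add: algebra_simps)
      then have "real l / 2 * ((1 - 2 * real l * \<epsilon>\<^sub>0) * d\<^sub>0) \<le>
          real l / 2 * (d\<^sub>0 - \<epsilon>\<^sub>0 * d\<^sub>0 / 2 - 1 - (real l - 1) * (\<epsilon>\<^sub>0 * d\<^sub>0))"
        by (intro mult_left_mono) auto
      then show ?thesis
        by (simp add: k_def mult.assoc)
    qed
    ultimately show False
      using no_minor order_trans by blast
  qed
  then obtain a where "a \<in> R" and large: "\<epsilon>\<^sub>0 * d\<^sub>0 / 2 \<le> card (C a)"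
    by blast
  then have "a \<in> A"
    using R by auto
  have "\<forall>b \<in> C a. \<exists>a'. f a' = Some b \<and> conf a a'"
    by (auto simp: C_def slot_compatible_def)
  then obtain g where g: "\<And>b. b \<in> C a \<Longrightarrow> f (g b) = Some b \<and> conf a (g b)"
    by metis
  \<comment> \<open>\<open>f\<close> recovers \<open>b\<close> from \<open>g b\<close>: a vertex
    occupies only one slot.\<close>
  have "inj_on g (C a)"
    using g by (metis inj_onI option.inject)
  then have card_g: "card (g ` C a) = card (C a)"
    by (rule card_image)
  have "\<epsilon>\<^sub>0 * d\<^sub>0 \<le> card {b \<in> N a. (a', b) \<in> parcs G}" if "a' \<in> g ` C a" for a'
  proof -
    have a': "a' \<in> A" "conf a a'"
      using that g fA(1) by auto
    \<comment> \<open>Conflict with \<open>a\<close> supplies the degree bound: \<open>a'\<close> is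
      adjacent to all of \<open>N a'\<close>, hence to the large overlap with
      \<open>N a\<close>.\<close>
    have "card (N a \<inter> N a') \<le> card {b \<in> N a. (a', b) \<in> parcs G}"
      using N[OF a'(1)] finN[OF \<open>a \<in> A\<close>] by (intro card_mono) auto
    then show ?thesis
      using a'(2) by (simp add: conf_def)
  qed
  then obtain H where H: "pair_graph H" "subgraph (with_proj H) (with_proj G)"
    "card (pverts H) \<le> card (g ` C a) + card (N a)" "card (g ` C a) * (\<epsilon>\<^sub>0 * d\<^sub>0) \<le> card (uedges H)"
    using bipartite_subgraph_with_many_edges[OF assms(5,6), of "g ` C a" "N a" "\<epsilon>\<^sub>0 * d\<^sub>0"]
      g fA(1) N[OF \<open>a \<in> A\<close>] by blast
  have "card (C a) \<le> D"
    using cardN[OF \<open>a \<in> A\<close>] card_mono[OF finN[OF \<open>a \<in> A\<close>], of "C a"] by (auto simp: C_def)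
  \<comment> \<open>Both sides have at most \<open>D\<close> vertices, and
    \<open>2 * D < 2 * d\<^sub>0 + 2 < 3 * d\<^sub>0\<close>.\<close>
  then have "real (card (pverts H)) \<le> 3 * d\<^sub>0"
    using H(3) card_g cardN[OF \<open>a \<in> A\<close>] D \<open>4 < d\<^sub>0\<close> by linarith
  moreover have "\<epsilon>\<^sub>0 * d\<^sub>0 / 2 * (\<epsilon>\<^sub>0 * d\<^sub>0) \<le> card (C a) * (\<epsilon>\<^sub>0 * d\<^sub>0)"
    using large \<open>1 \<le> \<epsilon>\<^sub>0 * d\<^sub>0\<close> by (intro mult_right_mono) auto
  then have "\<epsilon>\<^sub>0\<^sup>2 * d\<^sub>0\<^sup>2 / 2 \<le> card (uedges H)"
    using H(4) card_g by (simp add: power2_eq_square mult_ac)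
  ultimately show "\<exists>H :: 'a pair_pre_digraph. pair_graph H \<and> subgraph (with_proj H) (with_proj G) \<and>
            real (card (pverts H)) \<le> 3 * d\<^sub>0 \<and>
            real (card (uedges H)) \<ge> \<epsilon>\<^sub>0\<^sup>2 * d\<^sub>0\<^sup>2 / 2"
    using H(1,2) by blast
qed

end
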